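(* Let $\mathbb{D}$ be a small category and $\mathsf{K}$ a small $\mathsf{DCpo}^\vee$-enriched category admitting coproducts of all families indexed by objects of $\mathbb{D}$, with cotupling of such families preserving the order. Then the category $\widehat{\mathsf{K}}$ admits coproducts of all families indexed by objects of $\mathbb{D}$, with cotupling preserving the order.
   Context: $\mathsf{DCpo}^\vee$-enriched: hom-sets are posets with directed suprema and binary joins, composition monotone and preserving directed suprema in each variable. Cotupling preserves order: if $f_i\leq g_i:X_i\to Y$ for all $i$ then $[f_i]\leq[g_i]$. $\mathsf{DCpo}^\vee$ is the category of such posets with Scott-continuous maps, pointwise ordered. $\widetilde{\mathsf{K}}$ is the category of lax functors $\mathsf{K}\to\mathsf{DCpo}^\vee$ ($id\leq\pi(id)$, $\pi(g)\circ\pi(h)\leq\pi(g\circ h)$) with oplax transformations ($f_{X'}\circ\pi(g)\leq\pi'(g)\circ f_X$), ordered pointwise. $\widehat{X}=\mathsf{K}(X,-)$, and for $f:X\to X'$, $\widehat{f}=\mathsf{K}(f,-):\widehat{X'}\to\widehat{X}$ ($h\mapsto h\circ f$). $\widehat{\mathsf{K}}$ is the full subcategory of $\widetilde{\mathsf{K}}^{op}$ on the objects $\widehat{X}$, $X\in\mathsf{K}$, with order inherited from $\widetilde{\mathsf{K}}$. *)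

theory Defs
  imports "HOL-Algebra.Lattice"
begin

record ('o, 'a) category =
  Ob :: "'o set"
  Arr :: "'a set"
  Dom :: "'a \<Rightarrow> 'o"
  Cod :: "'a \<Rightarrow> 'o"
  Ident :: "'o \<Rightarrow> 'a"
  Comp :: "'a \<Rightarrow> 'a \<Rightarrow> 'a"  (infixr \<open>\<bullet>\<index>\<close> 70)

definition Hom :: "('o, 'a, 'm) category_scheme \<Rightarrow> 'o \<Rightarrow> 'o \<Rightarrow> 'a set" where
  "Hom C X Y = {f \<in> Arr C. Dom C f = X \<and> Cod C f = Y}"

locale category =
  fixes C :: "('o, 'a, 'm) category_scheme" (structure)
  assumes Dom_Ob: "f \<in> Arr C \<Longrightarrow> Dom C f \<in> Ob C"
    and Cod_Ob: "f \<in> Arr C \<Longrightarrow> Cod C f \<in> Ob C"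
    and Ident_Hom: "X \<in> Ob C \<Longrightarrow> Ident C X \<in> Hom C X X"
    and Comp_Hom: "\<lbrakk>f \<in> Hom C X Y; g \<in> Hom C Y Z\<rbrakk> \<Longrightarrow> g \<bullet> f \<in> Hom C X Z"
    and Comp_Ident: "f \<in> Hom C X Y \<Longrightarrow> f \<bullet> Ident C X = f"
    and Ident_Comp: "f \<in> Hom C X Y \<Longrightarrow> Ident C Y \<bullet> f = f"
    and Comp_assoc: "\<lbrakk>f \<in> Hom C W X; g \<in> Hom C X Y; h \<in> Hom C Y Z\<rbrakk>
      \<Longrightarrow> (h \<bullet> g) \<bullet> f = h \<bullet> (g \<bullet> f)"

definition opposite :: "('o, 'a, 'm) category_scheme \<Rightarrow> ('o, 'a, 'm) category_scheme" where
  "opposite C = C\<lparr>Dom := Cod C, Cod := Dom C, Comp := (\<lambda>g f. f \<bullet>\<^bsub>C\<^esub> g)\<rparr>"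

definition full_subcategory ::
  "('o, 'a, 'm) category_scheme \<Rightarrow> 'o set \<Rightarrow> ('o, 'a, 'm) category_scheme" where
  "full_subcategory C S = C\<lparr>Ob := S, Arr := {f \<in> Arr C. Dom C f \<in> S \<and> Cod C f \<in> S}\<rparr>"

definition is_coproduct ::
  "('o, 'a, 'm) category_scheme \<Rightarrow> 'i set \<Rightarrow> ('i \<Rightarrow> 'o) \<Rightarrow> 'o \<Rightarrow> ('i \<Rightarrow> 'a) \<Rightarrow> bool" where
  "is_coproduct C I X P \<iota> \<longleftrightarrow>
     P \<in> Ob C \<and> (\<forall>i\<in>I. \<iota> i \<in> Hom C (X i) P) \<and>
     (\<forall>Y\<in>Ob C. \<forall>f. (\<forall>i\<in>I. f i \<in> Hom C (X i) Y) \<longrightarrow>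
        (\<exists>!h. h \<in> Hom C P Y \<and> (\<forall>i\<in>I. h \<bullet>\<^bsub>C\<^esub> \<iota> i = f i)))"

definition has_coproducts :: "('o, 'a, 'm) category_scheme \<Rightarrow> 'i set \<Rightarrow> bool" where
  "has_coproducts C I \<longleftrightarrow> (\<forall>X \<in> I \<rightarrow> Ob C. \<exists>P \<iota>. is_coproduct C I X P \<iota>)"

text \<open>Only meaningful when \<open>P\<close>, \<open>\<iota>\<close> form a coproduct and \<open>f\<close> is a family of arrows into \<open>Y\<close>.\<close>
definition cotuple ::
  "('o, 'a, 'm) category_scheme \<Rightarrow> 'i set \<Rightarrow> 'o \<Rightarrow> ('i \<Rightarrow> 'a) \<Rightarrow> 'o \<Rightarrow> ('i \<Rightarrow> 'a) \<Rightarrow> 'a" where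
  "cotuple C I P \<iota> Y f = (THE h. h \<in> Hom C P Y \<and> (\<forall>i\<in>I. h \<bullet>\<^bsub>C\<^esub> \<iota> i = f i))"

text \<open>The relation \<open>Leq\<close> is only meant to be used on parallel arrows.\<close>
record ('o, 'a) ord_category = "('o, 'a) category" +
  Leq :: "'a \<Rightarrow> 'a \<Rightarrow> bool"  (infix \<open>\<preceq>\<index>\<close> 50)

text \<open>The order is cut down to the carrier, so that the hom-poset is determined by the
  hom-set and its order alone.\<close>
definition hom_poset :: "('o, 'a, 'm) ord_category_scheme \<Rightarrow> 'o \<Rightarrow> 'o \<Rightarrow> 'a gorder" where
  "hom_poset C X Y =
     \<lparr>carrier = Hom C X Y, eq = (=),
      le = (\<lambda>f g. f \<in> Hom C X Y \<and> g \<in> Hom C X Y \<and> f \<preceq>\<^bsub>C\<^esub> g)\<rparr>"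

text \<open>Coproducts are determined only up to isomorphism; the condition is imposed on every
  coproduct of every family of objects indexed by \<open>I\<close>.\<close>
definition cotupling_preserves_order ::
  "('o, 'a, 'm) ord_category_scheme \<Rightarrow> 'i set \<Rightarrow> bool" where
  "cotupling_preserves_order C I \<longleftrightarrow>
     (\<forall>X \<in> I \<rightarrow> Ob C. \<forall>P \<iota>. is_coproduct C I X P \<iota> \<longrightarrow>
        (\<forall>Y\<in>Ob C. \<forall>f g.
           (\<forall>i\<in>I. f i \<in> Hom C (X i) Y \<and> g i \<in> Hom C (X i) Y \<and> f i \<preceq>\<^bsub>C\<^esub> g i) \<longrightarrow>
           cotuple C I P \<iota> Y f \<preceq>\<^bsub>C\<^esub> cotuple C I P \<iota> Y g))"

definition directed :: "('v, 'm) gorder_scheme \<Rightarrow> 'v set \<Rightarrow> bool" where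
  "directed P S \<longleftrightarrow> S \<subseteq> carrier P \<and> S \<noteq> {} \<and>
     (\<forall>x\<in>S. \<forall>y\<in>S. \<exists>z\<in>S. x \<sqsubseteq>\<^bsub>P\<^esub> z \<and> y \<sqsubseteq>\<^bsub>P\<^esub> z)"

locale dcpo_join = upper_semilattice P for P :: "('v, 'm) gorder_scheme" (structure) +
  assumes directed_sup_exists: "directed P S \<Longrightarrow> \<exists>s. is_lub P s S"

definition scott_continuous ::
  "('v, 'm) gorder_scheme \<Rightarrow> ('w, 'n) gorder_scheme \<Rightarrow> ('v \<Rightarrow> 'w) \<Rightarrow> bool" where
  "scott_continuous P Q f \<longleftrightarrow>
     f \<in> carrier P \<rightarrow> carrier Q \<and> isotone P Q f \<and>
     (\<forall>S s. directed P S \<and> is_lub P s S \<longrightarrow> is_lub Q (f s) (f ` S))"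

text \<open>The category of such posets with underlying set in the type \<open>'v\<close>. An arrow is a triple of
  domain, map and codomain, the map being \<^const>\<open>undefined\<close> outside the domain; the relation of an
  object is required to live on its carrier, so that equality of objects and arrows is the
  set-theoretic one.\<close>
definition DCpoJ ::
  "('v gorder, 'v gorder \<times> ('v \<Rightarrow> 'v) \<times> 'v gorder) ord_category" where
  "DCpoJ =
     \<lparr>Ob = {P. dcpo_join P \<and> (\<forall>x y. x \<sqsubseteq>\<^bsub>P\<^esub> y \<longrightarrow> x \<in> carrier P \<and> y \<in> carrier P)},
      Arr = {(P, f, Q).
         dcpo_join P \<and> (\<forall>x y. x \<sqsubseteq>\<^bsub>P\<^esub> y \<longrightarrow> x \<in> carrier P \<and> y \<in> carrier P) \<and>
         dcpo_join Q \<and> (\<forall>x y. x \<sqsubseteq>\<^bsub>Q\<^esub> y \<longrightarrow> x \<in> carrier Q \<and> y \<in> carrier Q) \<and>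
         f \<in> extensional (carrier P) \<and> scott_continuous P Q f},
      Dom = (\<lambda>(P, f, Q). P),
      Cod = (\<lambda>(P, f, Q). Q),
      Ident = (\<lambda>P. (P, \<lambda>x\<in>carrier P. x, P)),
      Comp = (\<lambda>(Q', g, R) (P, f, Q). (P, compose (carrier P) g f, R)),
      Leq = (\<lambda>(P, f, Q) (P', g, Q'). \<forall>x\<in>carrier P. f x \<sqsubseteq>\<^bsub>Q\<^esub> g x)\<rparr>"

locale DCpoJ_enriched = category K
  for K :: "('o, 'a, 'm) ord_category_scheme" (structure) +
  assumes hom_dcpo_join: "\<lbrakk>X \<in> Ob K; Y \<in> Ob K\<rbrakk> \<Longrightarrow> dcpo_join (hom_poset K X Y)"
    and comp_continuous_right: "\<lbrakk>X \<in> Ob K; g \<in> Hom K Y Z\<rbrakk>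
      \<Longrightarrow> scott_continuous (hom_poset K X Y) (hom_poset K X Z) (\<lambda>f. g \<bullet> f)"
    and comp_continuous_left: "\<lbrakk>Z \<in> Ob K; f \<in> Hom K X Y\<rbrakk>
      \<Longrightarrow> scott_continuous (hom_poset K Y Z) (hom_poset K X Z) (\<lambda>g. g \<bullet> f)"

record ('o, 'a, 'p, 'b) functor_data =
  FOb :: "'o \<Rightarrow> 'p"
  FArr :: "'a \<Rightarrow> 'b"

locale lax_functor =
  fixes C :: "('o, 'a, 'm) category_scheme"
    and L :: "('p, 'b, 'n) ord_category_scheme"
    and F :: "('o, 'a, 'p, 'b) functor_data"
  assumes FOb_Ob: "FOb F \<in> Ob C \<rightarrow>\<^sub>E Ob L"
    and FArr_extensional: "FArr F \<in> extensional (Arr C)"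
    and FArr_Hom: "f \<in> Hom C X Y \<Longrightarrow> FArr F f \<in> Hom L (FOb F X) (FOb F Y)"
    and lax_Ident: "X \<in> Ob C \<Longrightarrow> Ident L (FOb F X) \<preceq>\<^bsub>L\<^esub> FArr F (Ident C X)"
    and lax_Comp: "\<lbrakk>h \<in> Hom C X Y; g \<in> Hom C Y Z\<rbrakk>
      \<Longrightarrow> FArr F g \<bullet>\<^bsub>L\<^esub> FArr F h \<preceq>\<^bsub>L\<^esub> FArr F (g \<bullet>\<^bsub>C\<^esub> h)"

locale oplax_transformation =
  fixes C :: "('o, 'a, 'm) category_scheme"
    and L :: "('p, 'b, 'n) ord_category_scheme"
    and F G :: "('o, 'a, 'p, 'b) functor_data"
    and t :: "'o \<Rightarrow> 'b"
  assumes extensional: "t \<in> extensional (Ob C)"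
    and component_Hom: "X \<in> Ob C \<Longrightarrow> t X \<in> Hom L (FOb F X) (FOb G X)"
    and oplax: "g \<in> Hom C X X'
      \<Longrightarrow> t X' \<bullet>\<^bsub>L\<^esub> FArr F g \<preceq>\<^bsub>L\<^esub> FArr G g \<bullet>\<^bsub>L\<^esub> t X"

definition lax_functor_category ::
  "('o, 'a, 'm) category_scheme \<Rightarrow> ('p, 'b, 'n) ord_category_scheme \<Rightarrow>
   (('o, 'a, 'p, 'b) functor_data,
    ('o, 'a, 'p, 'b) functor_data \<times> ('o \<Rightarrow> 'b) \<times> ('o, 'a, 'p, 'b) functor_data) ord_category" where
  "lax_functor_category C L =
     \<lparr>Ob = {F. lax_functor C L F},
      Arr = {(F, t, G). lax_functor C L F \<and> lax_functor C L G \<and> oplax_transformation C L F G t},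
      Dom = (\<lambda>(F, t, G). F),
      Cod = (\<lambda>(F, t, G). G),
      Ident = (\<lambda>F. (F, \<lambda>X\<in>Ob C. Ident L (FOb F X), F)),
      Comp = (\<lambda>(G', s, H) (F, t, G). (F, \<lambda>X\<in>Ob C. s X \<bullet>\<^bsub>L\<^esub> t X, H)),
      Leq = (\<lambda>(F, s, G) (F', t, G'). \<forall>X\<in>Ob C. s X \<preceq>\<^bsub>L\<^esub> t X)\<rparr>"

definition representable ::
  "('o, 'a, 'm) ord_category_scheme \<Rightarrow> 'o \<Rightarrow>
   ('o, 'a, 'a gorder, 'a gorder \<times> ('a \<Rightarrow> 'a) \<times> 'a gorder) functor_data" where
  "representable K X =
     \<lparr>FOb = (\<lambda>Y\<in>Ob K. hom_poset K X Y),
      FArr = (\<lambda>g\<in>Arr K.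
        (hom_poset K X (Dom K g), \<lambda>f\<in>Hom K X (Dom K g). g \<bullet>\<^bsub>K\<^esub> f, hom_poset K X (Cod K g)))\<rparr>"

text \<open>The values of representables have their elements among the arrows of \<open>K\<close>. Since the
  subcategory is full, only the hom-sets between representables matter, so it suffices to take
  lax functors into the posets over the type of arrows of \<open>K\<close>.\<close>
definition hat_category ::
  "('o, 'a, 'm) ord_category_scheme \<Rightarrow>
   (('o, 'a, 'a gorder, 'a gorder \<times> ('a \<Rightarrow> 'a) \<times> 'a gorder) functor_data,
    ('o, 'a, 'a gorder, 'a gorder \<times> ('a \<Rightarrow> 'a) \<times> 'a gorder) functor_data \<times>
    ('o \<Rightarrow> 'a gorder \<times> ('a \<Rightarrow> 'a) \<times> 'a gorder) \<times>
    ('o, 'a, 'a gorder, 'a gorder \<times> ('a \<Rightarrow> 'a) \<times> 'a gorder) functor_data) ord_category" where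
  "hat_category K =
     full_subcategory (opposite (lax_functor_category K DCpoJ)) (representable K ` Ob K)"

end

theory Submission
  imports Defs
begin

text \<open>If \<open>P\<close> with injections \<open>\<iota> i\<close> is a coproduct of the \<open>X i\<close> in \<open>K\<close>, then \<open>K(P, -)\<close> is a coproduct
  of the \<open>K(X i, -)\<close> in the opposite of the lax functor category: oplax transformations
  \<open>\<tau> i : K(Y, -) \<rightarrow> K(X i, -)\<close> are combined into \<open>h \<mapsto> [\<tau> i h]\<close>, the only transformation whose
  composites with the \<open>\<iota> i\<close> are the \<open>\<tau> i\<close>. Since cotupling in \<open>K\<close> is monotone and every arrow \<open>u\<close> out
  of \<open>P\<close> is the cotuple of the \<open>u \<bullet> \<iota> i\<close>, inequalities between arrows out of \<open>P\<close> can be tested on the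
  injections. This gives Scott continuity and the oplax inequality for the combined
  transformation as well as monotonicity of cotupling.\<close>

section \<open>Scott-continuous maps\<close>

text \<open>Scott continuity speaks of directed sets only, so the image of one must be directed
  again before a second Scott-continuous map can be applied to it.\<close>

lemma directed_image:
  assumes "directed P S" and "isotone P Q f" and "f \<in> carrier P \<rightarrow> carrier Q"
  shows "directed Q (f ` S)"
proof -
  have S: "S \<subseteq> carrier P" "S \<noteq> {}" using assms(1) by (auto simp: directed_def)
  have "\<exists>z\<in>f ` S. f x \<sqsubseteq>\<^bsub>Q\<^esub> z \<and> f y \<sqsubseteq>\<^bsub>Q\<^esub> z" if "x \<in> S" "y \<in> S" for x y
  proof -
    obtain z where "z \<in> S" "x \<sqsubseteq>\<^bsub>P\<^esub> z" "y \<sqsubseteq>\<^bsub>P\<^esub> z"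
      using assms(1) \<open>x \<in> S\<close> \<open>y \<in> S\<close> unfolding directed_def by blast
    moreover from this have "x \<in> carrier P" "y \<in> carrier P" "z \<in> carrier P" using S that by auto
    ultimately show ?thesis using assms(2) by (auto simp: isotone_def)
  qed
  then show ?thesis using S assms(3) by (auto simp: directed_def)
qed

text \<open>The definition evaluates the map only on the carrier: \<open>S\<close> lies there by
  directedness, \<open>s\<close> as a least upper bound. Hence the restricted maps that form arrows
  of \<open>DCpoJ\<close> may be exchanged for unrestricted ones.\<close>

lemma scott_continuous_cong:
  assumes "\<And>x. x \<in> carrier P \<Longrightarrow> f x = g x"
  shows "scott_continuous P Q f \<longleftrightarrow> scott_continuous P Q g"
proof -
  have *: "scott_continuous P Q g"
    if f: "scott_continuous P Q f" and eq: "\<And>x. x \<in> carrier P \<Longrightarrow> f x = g x" for f g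
  proof -
    have "is_lub Q (g s) (g ` S)" if "directed P S" "is_lub P s S" for S s
    proof -
      have "S \<subseteq> carrier P" "s \<in> carrier P"
        using that by (auto simp: directed_def least_def)
      then have "g s = f s" "g ` S = f ` S" using eq by (auto simp: image_iff subset_iff)
      then show ?thesis using f that by (simp add: scott_continuous_def)
    qed
    moreover have "isotone P Q g" using f eq by (simp add: scott_continuous_def isotone_def)
    moreover have "g \<in> carrier P \<rightarrow> carrier Q"
      using f eq by (auto simp: scott_continuous_def Pi_iff)
    ultimately show ?thesis by (simp add: scott_continuous_def)
  qed
  show ?thesis using *[of f g] *[of g f] assms by auto
qed

lemma scott_continuous_ident:
  assumes "weak_partial_order P"
  shows "scott_continuous P P (\<lambda>x. x)"
  using assms by (simp add: scott_continuous_def isotone_def)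

lemma scott_continuous_comp:
  assumes "scott_continuous P Q f" and "scott_continuous Q R g"
  shows "scott_continuous P R (\<lambda>x. g (f x))"
proof -
  have "is_lub R (g (f s)) ((\<lambda>x. g (f x)) ` S)" if "directed P S" "is_lub P s S" for S s
  proof -
    have "directed Q (f ` S)" "is_lub Q (f s) (f ` S)"
      using assms(1) that directed_image by (auto simp: scott_continuous_def)
    then have "is_lub R (g (f s)) (g ` f ` S)" using assms(2) by (simp add: scott_continuous_def)
    then show ?thesis by (simp add: image_image)
  qed
  moreover have "isotone P R (\<lambda>x. g (f x))"
    using assms by (auto simp: scott_continuous_def isotone_def Pi_iff)
  ultimately show ?thesis using assms by (auto simp: scott_continuous_def Pi_iff)
qed

lemma scott_continuous_mono:
  assumes "scott_continuous P Q f" and "x \<in> carrier P" and "y \<in> carrier P" and "x \<sqsubseteq>\<^bsub>P\<^esub> y"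
  shows "f x \<sqsubseteq>\<^bsub>Q\<^esub> f y"
  using assms by (simp add: scott_continuous_def isotone_def)

lemma scott_continuous_closed:
  "\<lbrakk>scott_continuous P Q f; x \<in> carrier P\<rbrakk> \<Longrightarrow> f x \<in> carrier Q"
  by (auto simp: scott_continuous_def)

lemma dcpo_join_weak_partial_order: "dcpo_join P \<Longrightarrow> weak_partial_order P"
  by (simp add: dcpo_join_def upper_semilattice_def partial_order_def)


section \<open>Categories with preordered hom-sets\<close>

text \<open>These laws pass from \<open>DCpoJ\<close> to lax functor categories, to opposites and to
  full subcategories, which is how \<open>hat_category K\<close> acquires them.\<close>

locale preorder_category = category C
  for C :: "('o, 'a, 'm) ord_category_scheme" (structure) +
  assumes Leq_refl: "f \<in> Hom C X Y \<Longrightarrow> f \<preceq> f"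
    and Leq_trans: "\<lbrakk>f \<in> Hom C X Y; g \<in> Hom C X Y; h \<in> Hom C X Y; f \<preceq> g; g \<preceq> h\<rbrakk> \<Longrightarrow> f \<preceq> h"
    and Comp_mono: "\<lbrakk>f \<in> Hom C X Y; f' \<in> Hom C X Y; g \<in> Hom C Y Z; g' \<in> Hom C Y Z;
      f \<preceq> f'; g \<preceq> g'\<rbrakk> \<Longrightarrow> g \<bullet> f \<preceq> g' \<bullet> f'"

lemma (in category) Hom_Ob: "f \<in> Hom C X Y \<Longrightarrow> X \<in> Ob C \<and> Y \<in> Ob C"
  using Dom_Ob Cod_Ob by (auto simp: Hom_def)

section \<open>Opposites and full subcategories\<close>

lemma opposite_simps [simp]:
  "Ob (opposite C) = Ob C" "Arr (opposite C) = Arr C"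
  "Dom (opposite C) = Cod C" "Cod (opposite C) = Dom C"
  "Ident (opposite C) = Ident C" "Comp (opposite C) = (\<lambda>g f. f \<bullet>\<^bsub>C\<^esub> g)"
  "Hom (opposite C) X Y = Hom C Y X"
  by (auto simp: opposite_def Hom_def)

lemma Leq_opposite [simp]: "Leq (opposite C) = Leq C"
  by (simp add: opposite_def)

lemma full_subcategory_simps [simp]:
  "Ob (full_subcategory C S) = S"
  "Arr (full_subcategory C S) = {f \<in> Arr C. Dom C f \<in> S \<and> Cod C f \<in> S}" "Dom (full_subcategory C S) = Dom C"
  "Cod (full_subcategory C S) = Cod C" "Ident (full_subcategory C S) = Ident C"
  "Comp (full_subcategory C S) = Comp C"
  by (auto simp: full_subcategory_def)

lemma Leq_full_subcategory [simp]: "Leq (full_subcategory C S) = Leq C"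
  by (simp add: full_subcategory_def)

lemma Hom_full_subcategory:
  "Hom (full_subcategory C S) X Y = (if X \<in> S \<and> Y \<in> S then Hom C X Y else {})"
  by (auto simp: full_subcategory_def Hom_def)

lemma (in preorder_category) preorder_category_opposite: "preorder_category (opposite C)"
proof unfold_locales
  show "Comp (opposite C) (Comp (opposite C) h g) f = Comp (opposite C) h (Comp (opposite C) g f)"
    if "f \<in> Hom (opposite C) W X" "g \<in> Hom (opposite C) X Y" "h \<in> Hom (opposite C) Y Z"
    for f g h W X Y Z
    \<comment> \<open>Seen in \<open>C\<close> the three arrows run backwards, so associativity is
      taken for \<open>h\<close>, \<open>g\<close>, \<open>f\<close> in that order and read from
      right to left.\<close>
    using that Comp_assoc[of h Z Y g X f W] by simp
qed (use Dom_Ob Cod_Ob in \<open>auto intro: Ident_Hom Comp_Hom Comp_Ident Ident_Comp Leq_refl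
      Leq_trans Comp_mono\<close>)

lemma (in preorder_category) preorder_category_full_subcategory:
  assumes "S \<subseteq> Ob C"
  shows "preorder_category (full_subcategory C S)"
proof unfold_locales
  show "Ident (full_subcategory C S) X \<in> Hom (full_subcategory C S) X X"
    if "X \<in> Ob (full_subcategory C S)" for X
    using that assms Ident_Hom by (auto simp: Hom_full_subcategory)
qed (auto simp: Hom_full_subcategory intro: Comp_Hom Comp_Ident Ident_Comp
      Comp_assoc Leq_refl Leq_trans Comp_mono split: if_splits)

section \<open>Cotuples in an arbitrary category\<close>

lemma cotuple_equality:
  assumes "is_coproduct C I X P \<iota>" and "Y \<in> Ob C" and "\<And>i. i \<in> I \<Longrightarrow> f i \<in> Hom C (X i) Y"
    and "h \<in> Hom C P Y" and "\<And>i. i \<in> I \<Longrightarrow> h \<bullet>\<^bsub>C\<^esub> \<iota> i = f i"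
  shows "cotuple C I P \<iota> Y f = h"
proof -
  have "\<exists>!h. h \<in> Hom C P Y \<and> (\<forall>i\<in>I. h \<bullet>\<^bsub>C\<^esub> \<iota> i = f i)"
    using assms(1-3) by (simp add: is_coproduct_def)
  then show ?thesis unfolding cotuple_def using assms(4,5) by (blast intro: the1_equality)
qed

lemma
  assumes "is_coproduct C I X P \<iota>" and "Y \<in> Ob C" and "\<And>i. i \<in> I \<Longrightarrow> f i \<in> Hom C (X i) Y"
  shows cotuple_Hom: "cotuple C I P \<iota> Y f \<in> Hom C P Y"
    and cotuple_Comp: "i \<in> I \<Longrightarrow> cotuple C I P \<iota> Y f \<bullet>\<^bsub>C\<^esub> \<iota> i = f i"
proof -
  have "\<exists>!h. h \<in> Hom C P Y \<and> (\<forall>i\<in>I. h \<bullet>\<^bsub>C\<^esub> \<iota> i = f i)"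
    using assms by (simp add: is_coproduct_def)
  from theI'[OF this] show "cotuple C I P \<iota> Y f \<in> Hom C P Y"
    and "i \<in> I \<Longrightarrow> cotuple C I P \<iota> Y f \<bullet>\<^bsub>C\<^esub> \<iota> i = f i"
    unfolding cotuple_def by auto
qed

lemma cotuple_mono:
  assumes "cotupling_preserves_order C I" and "X \<in> I \<rightarrow> Ob C" and "is_coproduct C I X P \<iota>"
    and "Y \<in> Ob C" and "\<And>i. i \<in> I \<Longrightarrow> f i \<in> Hom C (X i) Y" and "\<And>i. i \<in> I \<Longrightarrow> g i \<in> Hom C (X i) Y"
    and "\<And>i. i \<in> I \<Longrightarrow> f i \<preceq>\<^bsub>C\<^esub> g i"
  shows "cotuple C I P \<iota> Y f \<preceq>\<^bsub>C\<^esub> cotuple C I P \<iota> Y g"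
  using assms unfolding cotupling_preserves_order_def by blast

text \<open>Cotuples out of two coproducts of the same family differ by precomposition with the
  comparison arrow, so monotonicity need only be checked on one coproduct of each family.\<close>

lemma (in preorder_category) cotupling_preserves_orderI:
  assumes "\<And>X. X \<in> I \<rightarrow> Ob C \<Longrightarrow> \<exists>P \<iota>. is_coproduct C I X P \<iota> \<and>
    (\<forall>Y\<in>Ob C. \<forall>f g. (\<forall>i\<in>I. f i \<in> Hom C (X i) Y \<and> g i \<in> Hom C (X i) Y \<and> f i \<preceq> g i) \<longrightarrow>
       cotuple C I P \<iota> Y f \<preceq> cotuple C I P \<iota> Y g)"
  shows "cotupling_preserves_order C I"
  unfolding cotupling_preserves_order_def
proof (intro ballI allI impI)
  fix X P \<iota> Y f g
  assume X: "X \<in> I \<rightarrow> Ob C" and P: "is_coproduct C I X P \<iota>" and Y: "Y \<in> Ob C"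
    and fg: "\<forall>i\<in>I. f i \<in> Hom C (X i) Y \<and> g i \<in> Hom C (X i) Y \<and> f i \<preceq> g i"
  obtain Q \<kappa> where Q: "is_coproduct C I X Q \<kappa>"
    and le: "cotuple C I Q \<kappa> Y f \<preceq> cotuple C I Q \<kappa> Y g"
    using assms[OF X] Y fg by blast
  \<comment> \<open>This is the comparison arrow from the given coproduct \<open>P\<close> to
    \<open>Q\<close>, the coproduct on which monotonicity is known.\<close>
  define \<phi> where "\<phi> = cotuple C I P \<iota> Q \<kappa>"
  have Q_Ob: "Q \<in> Ob C" and \<kappa>: "\<And>i. i \<in> I \<Longrightarrow> \<kappa> i \<in> Hom C (X i) Q"
    and \<iota>: "\<And>i. i \<in> I \<Longrightarrow> \<iota> i \<in> Hom C (X i) P"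
    using P Q by (auto simp: is_coproduct_def)
  have \<phi>: "\<phi> \<in> Hom C P Q" "\<And>i. i \<in> I \<Longrightarrow> \<phi> \<bullet> \<iota> i = \<kappa> i"
    unfolding \<phi>_def using cotuple_Hom[OF P Q_Ob] cotuple_Comp[OF P Q_Ob] \<kappa> by auto
  have eq: "cotuple C I P \<iota> Y k = cotuple C I Q \<kappa> Y k \<bullet> \<phi>"
    if k: "\<And>i. i \<in> I \<Longrightarrow> k i \<in> Hom C (X i) Y" for k
  proof (rule cotuple_equality[OF P Y k])
    have c: "cotuple C I Q \<kappa> Y k \<in> Hom C Q Y" using cotuple_Hom[OF Q Y] k by blast
    show "cotuple C I Q \<kappa> Y k \<bullet> \<phi> \<in> Hom C P Y" using \<phi>(1) c by (rule Comp_Hom)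
    show "(cotuple C I Q \<kappa> Y k \<bullet> \<phi>) \<bullet> \<iota> i = k i" if "i \<in> I" for i
      using Comp_assoc[OF \<iota>[OF that] \<phi>(1) c] \<phi>(2)[OF that]
        cotuple_Comp[OF Q Y k that] by simp
  qed
  have "cotuple C I Q \<kappa> Y f \<bullet> \<phi> \<preceq> cotuple C I Q \<kappa> Y g \<bullet> \<phi>"
  proof (rule Comp_mono[OF \<phi>(1) \<phi>(1) _ _ Leq_refl[OF \<phi>(1)] le])
    show "cotuple C I Q \<kappa> Y f \<in> Hom C Q Y" "cotuple C I Q \<kappa> Y g \<in> Hom C Q Y"
      using cotuple_Hom[OF Q Y] fg by blast+
  qed
  then show "cotuple C I P \<iota> Y f \<preceq> cotuple C I P \<iota> Y g"
    using eq[of f] eq[of g] fg by simp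
qed


section \<open>The category of dcpos with joins\<close>

lemma DCpoJ_simps:
  "P \<in> Ob DCpoJ \<longleftrightarrow>
     dcpo_join P \<and> (\<forall>x y. x \<sqsubseteq>\<^bsub>P\<^esub> y \<longrightarrow> x \<in> carrier P \<and> y \<in> carrier P)"
  "Ident DCpoJ P = (P, \<lambda>x\<in>carrier P. x, P)"
  "(Q', g, R) \<bullet>\<^bsub>DCpoJ\<^esub> (P, f, Q) = (P, compose (carrier P) g f, R)"
  "(P, f, Q) \<preceq>\<^bsub>DCpoJ\<^esub> (P', f', Q') \<longleftrightarrow> (\<forall>x\<in>carrier P. f x \<sqsubseteq>\<^bsub>Q\<^esub> f' x)"
  by (simp_all add: DCpoJ_def)

lemma Hom_DCpoJ:
  "\<phi> \<in> Hom DCpoJ P Q \<longleftrightarrow> P \<in> Ob DCpoJ \<and> Q \<in> Ob DCpoJ \<and>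
     (\<exists>f. \<phi> = (P, f, Q) \<and> f \<in> extensional (carrier P) \<and> scott_continuous P Q f)"
  by (auto simp: DCpoJ_def Hom_def)

text \<open>Each law is the one for functions. Restriction to carriers does no harm because the maps
  send carriers into carriers; the pointwise order inherits reflexivity and transitivity from the
  codomain.\<close>

lemma preorder_category_DCpoJ: "preorder_category DCpoJ"
proof unfold_locales
  fix \<phi> assume "\<phi> \<in> Arr DCpoJ"
  then show "Dom DCpoJ \<phi> \<in> Ob DCpoJ" "Cod DCpoJ \<phi> \<in> Ob DCpoJ"
    by (auto simp: DCpoJ_def)
next
  fix P :: "'a gorder" assume P: "P \<in> Ob DCpoJ"
  then have "scott_continuous P P (\<lambda>x\<in>carrier P. x)"
    using scott_continuous_ident[of P] dcpo_join_weak_partial_order[of P]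
    by (subst scott_continuous_cong[where g = "\<lambda>x. x"]) (auto simp: DCpoJ_simps)
  with P show "Ident DCpoJ P \<in> Hom DCpoJ P P" by (auto simp: DCpoJ_simps(2) Hom_DCpoJ)
next
  fix \<phi> \<psi> and P Q R :: "'a gorder"
  assume \<phi>: "\<phi> \<in> Hom DCpoJ P Q" and \<psi>: "\<psi> \<in> Hom DCpoJ Q R"
  obtain f g where f: "\<phi> = (P, f, Q)" "scott_continuous P Q f"
    and g: "\<psi> = (Q, g, R)" "scott_continuous Q R g"
    using \<phi> \<psi> by (auto simp: Hom_DCpoJ)
  have "scott_continuous P R (compose (carrier P) g f)"
    using scott_continuous_comp[OF f(2) g(2)]
    by (subst scott_continuous_cong[where g = "\<lambda>x. g (f x)"]) (auto simp: compose_def)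
  then show "\<psi> \<bullet>\<^bsub>DCpoJ\<^esub> \<phi> \<in> Hom DCpoJ P R"
    using \<phi> \<psi> f(1) g(1) by (auto simp: Hom_DCpoJ DCpoJ_simps(3))
next
  fix \<phi> and P Q :: "'a gorder" assume \<phi>: "\<phi> \<in> Hom DCpoJ P Q"
  then obtain f where f: "\<phi> = (P, f, Q)" "f \<in> extensional (carrier P)" "f \<in> carrier P \<rightarrow> carrier Q"
    and Q: "dcpo_join Q"
    by (auto simp: Hom_DCpoJ scott_continuous_def DCpoJ_simps(1))
  show "\<phi> \<bullet>\<^bsub>DCpoJ\<^esub> Ident DCpoJ P = \<phi>"
    using f by (auto simp: DCpoJ_simps(2,3) compose_def extensional_def)
  show "Ident DCpoJ Q \<bullet>\<^bsub>DCpoJ\<^esub> \<phi> = \<phi>"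
    using f by (auto simp: DCpoJ_simps(2,3) compose_def extensional_def Pi_iff)
  interpret partial_order Q using Q by (simp add: dcpo_join_def upper_semilattice_def)
  show "\<phi> \<preceq>\<^bsub>DCpoJ\<^esub> \<phi>" using f by (auto simp: DCpoJ_simps(4))
next
  fix \<phi> \<psi> \<chi> and P Q R S :: "'a gorder"
  assume \<phi>: "\<phi> \<in> Hom DCpoJ P Q" and "\<psi> \<in> Hom DCpoJ Q R" and "\<chi> \<in> Hom DCpoJ R S"
  then obtain f g h where "\<phi> = (P, f, Q)" "\<psi> = (Q, g, R)" "\<chi> = (R, h, S)"
    by (auto simp: Hom_DCpoJ)
  moreover have "f \<in> carrier P \<rightarrow> carrier Q" if "\<phi> = (P, f, Q)" for f
    using \<phi> that by (auto simp: Hom_DCpoJ scott_continuous_def)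
  ultimately show "(\<chi> \<bullet>\<^bsub>DCpoJ\<^esub> \<psi>) \<bullet>\<^bsub>DCpoJ\<^esub> \<phi> = \<chi> \<bullet>\<^bsub>DCpoJ\<^esub> (\<psi> \<bullet>\<^bsub>DCpoJ\<^esub> \<phi>)"
    by (auto simp: DCpoJ_simps(3) compose_def Pi_iff)
next
  fix \<phi> \<psi> \<chi> and P Q :: "'a gorder"
  assume "\<phi> \<in> Hom DCpoJ P Q" "\<psi> \<in> Hom DCpoJ P Q" "\<chi> \<in> Hom DCpoJ P Q"
  then obtain f g h where *: "\<phi> = (P, f, Q)" "\<psi> = (P, g, Q)" "\<chi> = (P, h, Q)"
    "f \<in> carrier P \<rightarrow> carrier Q" "g \<in> carrier P \<rightarrow> carrier Q" "h \<in> carrier P \<rightarrow> carrier Q"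
    and Q: "dcpo_join Q"
    by (auto simp: Hom_DCpoJ scott_continuous_def DCpoJ_simps(1))
  assume "\<phi> \<preceq>\<^bsub>DCpoJ\<^esub> \<psi>" "\<psi> \<preceq>\<^bsub>DCpoJ\<^esub> \<chi>"
  interpret partial_order Q using Q by (simp add: dcpo_join_def upper_semilattice_def)
  show "\<phi> \<preceq>\<^bsub>DCpoJ\<^esub> \<chi>"
    using * \<open>\<phi> \<preceq>\<^bsub>DCpoJ\<^esub> \<psi>\<close> \<open>\<psi> \<preceq>\<^bsub>DCpoJ\<^esub> \<chi>\<close>
    by (auto simp: DCpoJ_simps(4) Pi_iff intro: le_trans)
next
  fix \<phi> \<phi>' \<psi> \<psi>' and P Q R :: "'a gorder"
  assume "\<phi> \<in> Hom DCpoJ P Q" "\<phi>' \<in> Hom DCpoJ P Q" "\<psi> \<in> Hom DCpoJ Q R" "\<psi>' \<in> Hom DCpoJ Q R"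
    and le: "\<phi> \<preceq>\<^bsub>DCpoJ\<^esub> \<phi>'" "\<psi> \<preceq>\<^bsub>DCpoJ\<^esub> \<psi>'"
  then obtain f f' g g' where *: "\<phi> = (P, f, Q)" "\<phi>' = (P, f', Q)" "\<psi> = (Q, g, R)" "\<psi>' = (Q, g', R)"
    and sc: "scott_continuous P Q f" "scott_continuous P Q f'"
      "scott_continuous Q R g" "scott_continuous Q R g'"
    and R: "dcpo_join R"
    by (auto simp: Hom_DCpoJ DCpoJ_simps(1))
  interpret partial_order R using R by (simp add: dcpo_join_def upper_semilattice_def)
  \<comment> \<open>The middle term is \<open>g (f' x)\<close>: the first inequality uses that
    \<open>g\<close> is monotone, the second compares \<open>g\<close> and \<open>g'\<close> at the
    point \<open>f' x\<close>.\<close>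
  have "g (f x) \<sqsubseteq>\<^bsub>R\<^esub> g' (f' x)" if x: "x \<in> carrier P" for x
  proof (rule le_trans)
    note [simp] = scott_continuous_closed[OF sc(1) x] scott_continuous_closed[OF sc(2) x]
    show "g (f x) \<sqsubseteq>\<^bsub>R\<^esub> g (f' x)"
      using le(1) x * by (intro scott_continuous_mono[OF sc(3)]) (auto simp: DCpoJ_simps(4))
    show "g (f' x) \<sqsubseteq>\<^bsub>R\<^esub> g' (f' x)"
      using le(2) * by (auto simp: DCpoJ_simps(4))
  qed (use x sc in \<open>auto intro: scott_continuous_closed\<close>)
  then show "\<psi> \<bullet>\<^bsub>DCpoJ\<^esub> \<phi> \<preceq>\<^bsub>DCpoJ\<^esub> \<psi>' \<bullet>\<^bsub>DCpoJ\<^esub> \<phi>'"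
    using * by (auto simp: DCpoJ_simps(3,4) compose_def)
qed


section \<open>Lax functors and oplax transformations\<close>

lemma lax_functor_category_simps:
  "F \<in> Ob (lax_functor_category C L) \<longleftrightarrow> lax_functor C L F"
  "Ident (lax_functor_category C L) F = (F, \<lambda>X\<in>Ob C. Ident L (FOb F X), F)"
  "(G', s, H) \<bullet>\<^bsub>lax_functor_category C L\<^esub> (F, t, G) = (F, \<lambda>X\<in>Ob C. s X \<bullet>\<^bsub>L\<^esub> t X, H)"
  "(F, t, G) \<preceq>\<^bsub>lax_functor_category C L\<^esub> (F', t', G') \<longleftrightarrow> (\<forall>X\<in>Ob C. t X \<preceq>\<^bsub>L\<^esub> t' X)"
  by (simp_all add: lax_functor_category_def)

lemma Hom_lax_functor_category:
  "\<phi> \<in> Hom (lax_functor_category C L) F G \<longleftrightarrow> lax_functor C L F \<and> lax_functor C L G \<and>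
     (\<exists>t. \<phi> = (F, t, G) \<and> oplax_transformation C L F G t)"
  by (auto simp: lax_functor_category_def Hom_def)

text \<open>By the unit laws both sides of the oplax inequality equal
  \<open>FArr F g\<close>.\<close>

lemma oplax_transformation_Ident:
  assumes "category C" and "preorder_category L" and "lax_functor C L F"
  shows "oplax_transformation C L F F (\<lambda>X\<in>Ob C. Ident L (FOb F X))"
proof
  interpret C: category C by fact
  interpret L: preorder_category L by fact
  interpret F: lax_functor C L F by fact
  show "(\<lambda>X\<in>Ob C. Ident L (FOb F X)) X \<in> Hom L (FOb F X) (FOb F X)" if "X \<in> Ob C" for X
    using that F.FOb_Ob L.Ident_Hom by auto
  show "(\<lambda>X\<in>Ob C. Ident L (FOb F X)) Y \<bullet>\<^bsub>L\<^esub> FArr F g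
      \<preceq>\<^bsub>L\<^esub> FArr F g \<bullet>\<^bsub>L\<^esub> (\<lambda>X\<in>Ob C. Ident L (FOb F X)) X" if "g \<in> Hom C X Y" for X Y g
    using C.Hom_Ob[OF that] F.FArr_Hom[OF that]
    by (simp add: L.Ident_Comp L.Comp_Ident L.Leq_refl)
qed simp

text \<open>The two oplax squares are pasted: \<open>t\<close> is moved past \<open>g\<close>
  underneath \<open>s Y\<close>, then \<open>s\<close> is moved past \<open>g\<close> on top of
  \<open>t X\<close>. Associativity of \<open>L\<close> joins the two inequalities.\<close>

lemma oplax_transformation_Comp:
  assumes "category C" and "preorder_category L" and "lax_functor C L F" and "lax_functor C L G"
    and "lax_functor C L H"
    and "oplax_transformation C L F G t" and "oplax_transformation C L G H s"
  shows "oplax_transformation C L F H (\<lambda>X\<in>Ob C. s X \<bullet>\<^bsub>L\<^esub> t X)"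
proof
  interpret C: category C by fact
  interpret L: preorder_category L by fact
  interpret F: lax_functor C L F by fact
  interpret G: lax_functor C L G by fact
  interpret H: lax_functor C L H by fact
  interpret t: oplax_transformation C L F G t by fact
  interpret s: oplax_transformation C L G H s by fact
  show "(\<lambda>X\<in>Ob C. s X \<bullet>\<^bsub>L\<^esub> t X) X \<in> Hom L (FOb F X) (FOb H X)" if "X \<in> Ob C" for X
    using that L.Comp_Hom[OF t.component_Hom s.component_Hom] by simp
  show "(\<lambda>X\<in>Ob C. s X \<bullet>\<^bsub>L\<^esub> t X) Y \<bullet>\<^bsub>L\<^esub> FArr F g
      \<preceq>\<^bsub>L\<^esub> FArr H g \<bullet>\<^bsub>L\<^esub> (\<lambda>X\<in>Ob C. s X \<bullet>\<^bsub>L\<^esub> t X) X" if g: "g \<in> Hom C X Y" for X Y g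
  proof -
    note X = conjunct1[OF C.Hom_Ob[OF g]] and Y = conjunct2[OF C.Hom_Ob[OF g]]
    note tX = t.component_Hom[OF X] and tY = t.component_Hom[OF Y]
    note sX = s.component_Hom[OF X] and sY = s.component_Hom[OF Y]
    note Fg = F.FArr_Hom[OF g] and Gg = G.FArr_Hom[OF g] and Hg = H.FArr_Hom[OF g]
    have "s Y \<bullet>\<^bsub>L\<^esub> (t Y \<bullet>\<^bsub>L\<^esub> FArr F g) \<preceq>\<^bsub>L\<^esub> s Y \<bullet>\<^bsub>L\<^esub> (FArr G g \<bullet>\<^bsub>L\<^esub> t X)"
      by (rule L.Comp_mono[OF L.Comp_Hom[OF Fg tY] L.Comp_Hom[OF tX Gg] sY sY
            t.oplax[OF g] L.Leq_refl[OF sY]])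
    moreover have "(s Y \<bullet>\<^bsub>L\<^esub> FArr G g) \<bullet>\<^bsub>L\<^esub> t X \<preceq>\<^bsub>L\<^esub> (FArr H g \<bullet>\<^bsub>L\<^esub> s X) \<bullet>\<^bsub>L\<^esub> t X"
      by (rule L.Comp_mono[OF tX tX L.Comp_Hom[OF Gg sY] L.Comp_Hom[OF sX Hg]
            L.Leq_refl[OF tX] s.oplax[OF g]])
    ultimately have "(s Y \<bullet>\<^bsub>L\<^esub> t Y) \<bullet>\<^bsub>L\<^esub> FArr F g \<preceq>\<^bsub>L\<^esub> FArr H g \<bullet>\<^bsub>L\<^esub> (s X \<bullet>\<^bsub>L\<^esub> t X)"
      using L.Leq_trans[OF L.Comp_Hom[OF Fg L.Comp_Hom[OF tY sY]]
          L.Comp_Hom[OF L.Comp_Hom[OF tX Gg] sY] L.Comp_Hom[OF L.Comp_Hom[OF tX sX] Hg]]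
      by (simp add: L.Comp_assoc[OF Fg tY sY] L.Comp_assoc[OF tX Gg sY] L.Comp_assoc[OF tX sX Hg])
    then show ?thesis using X Y by simp
  qed
qed simp

text \<open>Identities, composites and order are componentwise, so each law is the law of
  \<open>L\<close> at every object of \<open>C\<close>.\<close>

lemma preorder_category_lax_functor_category:
  assumes "category C" and "preorder_category L"
  shows "preorder_category (lax_functor_category C L)"
proof -
  interpret C: category C by fact
  interpret L: preorder_category L by fact
  let ?N = "lax_functor_category C L"
  note simps = lax_functor_category_simps(2-4) Hom_lax_functor_category
  note comp = oplax_transformation.component_Hom
  show ?thesis
  proof unfold_locales
    fix \<phi> assume "\<phi> \<in> Arr ?N"
    then show "Dom ?N \<phi> \<in> Ob ?N" "Cod ?N \<phi> \<in> Ob ?N"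
      by (auto simp: lax_functor_category_def)
  next
    fix F assume "F \<in> Ob ?N"
    then show "Ident ?N F \<in> Hom ?N F F"
      using oplax_transformation_Ident[OF assms] by (simp add: simps lax_functor_category_simps(1))
  next
    fix \<phi> \<psi> F G H assume "\<phi> \<in> Hom ?N F G" "\<psi> \<in> Hom ?N G H"
    then show "\<psi> \<bullet>\<^bsub>?N\<^esub> \<phi> \<in> Hom ?N F H"
      using oplax_transformation_Comp[OF assms] by (auto simp: simps)
  next
    fix \<phi> F G assume "\<phi> \<in> Hom ?N F G"
    then obtain t where t: "\<phi> = (F, t, G)" and "oplax_transformation C L F G t"
      by (auto simp: simps)
    then interpret t: oplax_transformation C L F G t by simp
    \<comment> \<open>Outside \<open>Ob C\<close> both sides are \<open>undefined\<close>, because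
      \<open>t\<close> is extensional; on \<open>Ob C\<close> the unit laws of \<open>L\<close>
      apply.\<close>
    show "\<phi> \<bullet>\<^bsub>?N\<^esub> Ident ?N F = \<phi>" "Ident ?N G \<bullet>\<^bsub>?N\<^esub> \<phi> = \<phi>"
      using t t.extensional t.component_Hom
      by (auto simp: simps intro!: extensionalityI[where A = "Ob C"] L.Comp_Ident L.Ident_Comp)
    show "\<phi> \<preceq>\<^bsub>?N\<^esub> \<phi>"
      using t t.component_Hom L.Leq_refl by (auto simp: simps)
  next
    fix \<phi> \<psi> \<chi> F G H J
    assume "\<phi> \<in> Hom ?N F G" "\<psi> \<in> Hom ?N G H" "\<chi> \<in> Hom ?N H J"
    then show "(\<chi> \<bullet>\<^bsub>?N\<^esub> \<psi>) \<bullet>\<^bsub>?N\<^esub> \<phi> = \<chi> \<bullet>\<^bsub>?N\<^esub> (\<psi> \<bullet>\<^bsub>?N\<^esub> \<phi>)"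
      by (auto simp: simps intro!: restrict_ext) (blast dest: comp intro: L.Comp_assoc)
  next
    fix \<phi> \<psi> \<chi> F G
    assume "\<phi> \<in> Hom ?N F G" "\<psi> \<in> Hom ?N F G" "\<chi> \<in> Hom ?N F G" "\<phi> \<preceq>\<^bsub>?N\<^esub> \<psi>" "\<psi> \<preceq>\<^bsub>?N\<^esub> \<chi>"
    then show "\<phi> \<preceq>\<^bsub>?N\<^esub> \<chi>"
      by (auto simp: simps) (blast dest: comp intro: L.Leq_trans)
  next
    fix \<phi> \<phi>' \<psi> \<psi>' F G H
    assume "\<phi> \<in> Hom ?N F G" "\<phi>' \<in> Hom ?N F G" "\<psi> \<in> Hom ?N G H" "\<psi>' \<in> Hom ?N G H"
      "\<phi> \<preceq>\<^bsub>?N\<^esub> \<phi>'" "\<psi> \<preceq>\<^bsub>?N\<^esub> \<psi>'"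
    then show "\<psi> \<bullet>\<^bsub>?N\<^esub> \<phi> \<preceq>\<^bsub>?N\<^esub> \<psi>' \<bullet>\<^bsub>?N\<^esub> \<phi>'"
      by (auto simp: simps) (blast dest: comp intro: L.Comp_mono)
  qed
qed


section \<open>Transformations between representables\<close>

lemma hom_poset_simps [simp]:
  "carrier (hom_poset K X Y) = Hom K X Y"
  "f \<sqsubseteq>\<^bsub>hom_poset K X Y\<^esub> g \<longleftrightarrow> f \<in> Hom K X Y \<and> g \<in> Hom K X Y \<and> f \<preceq>\<^bsub>K\<^esub> g"
  by (simp_all add: hom_poset_def)

text \<open>\<open>oplax_family K X Y \<tau>\<close> describes an oplax transformation \<open>K(X, -) \<rightarrow> K(Y, -)\<close>, and
  \<open>transformation K X Y \<tau>\<close> is the same data as an arrow of \<^term>\<open>hat_category K\<close>, where it goes from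
  \<^term>\<open>representable K Y\<close> to \<^term>\<open>representable K X\<close>.\<close>

definition oplax_family ::
  "('o, 'a, 'm) ord_category_scheme \<Rightarrow> 'o \<Rightarrow> 'o \<Rightarrow> ('o \<Rightarrow> 'a \<Rightarrow> 'a) \<Rightarrow> bool" where
  "oplax_family K X Y \<tau> \<longleftrightarrow>
     (\<forall>Z\<in>Ob K. scott_continuous (hom_poset K X Z) (hom_poset K Y Z) (\<tau> Z)) \<and>
     (\<forall>Z Z' g h. g \<in> Hom K Z Z' \<longrightarrow> h \<in> Hom K X Z \<longrightarrow> \<tau> Z' (g \<bullet>\<^bsub>K\<^esub> h) \<preceq>\<^bsub>K\<^esub> g \<bullet>\<^bsub>K\<^esub> \<tau> Z h)"

definition transformation ::
  "('o, 'a, 'm) ord_category_scheme \<Rightarrow> 'o \<Rightarrow> 'o \<Rightarrow> ('o \<Rightarrow> 'a \<Rightarrow> 'a) \<Rightarrow>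
   ('o, 'a, 'a gorder, 'a gorder \<times> ('a \<Rightarrow> 'a) \<times> 'a gorder) functor_data \<times>
   ('o \<Rightarrow> 'a gorder \<times> ('a \<Rightarrow> 'a) \<times> 'a gorder) \<times>
   ('o, 'a, 'a gorder, 'a gorder \<times> ('a \<Rightarrow> 'a) \<times> 'a gorder) functor_data" where
  "transformation K X Y \<tau> =
     (representable K X,
      \<lambda>Z\<in>Ob K. (hom_poset K X Z, \<lambda>h\<in>Hom K X Z. \<tau> Z h, hom_poset K Y Z),
      representable K Y)"

text \<open>Components are restricted to objects and hom-sets, which hides all other values of a
  family. Equations between arrows of \<open>hat_category K\<close> thereby become equations in
  \<open>K\<close>.\<close>

lemma transformation_eq_iff:
  "transformation K X Y \<sigma> = transformation K X Y \<tau> \<longleftrightarrow>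
     (\<forall>Z\<in>Ob K. \<forall>h\<in>Hom K X Z. \<sigma> Z h = \<tau> Z h)"
  by (auto simp: transformation_def fun_eq_iff restrict_def)

lemma Ob_hat_category: "Ob (hat_category K) = representable K ` Ob K"
  by (simp add: hat_category_def)

context DCpoJ_enriched
begin

lemma hom_Leq_refl: "f \<in> Hom K X Y \<Longrightarrow> f \<preceq> f"
  using Hom_Ob[of f X Y] weak_partial_order.le_refl[of "hom_poset K X Y" f]
    dcpo_join_weak_partial_order[OF hom_dcpo_join[of X Y]] by simp

lemma hom_poset_Ob: "\<lbrakk>X \<in> Ob K; Y \<in> Ob K\<rbrakk> \<Longrightarrow> hom_poset K X Y \<in> Ob DCpoJ"
  using hom_dcpo_join by (simp add: DCpoJ_simps(1))

text \<open>It serves both for postcomposition maps, where \<open>X' = X\<close>, and for components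
  of transformations, where \<open>Y' = Y\<close>.\<close>

lemma restrict_Hom_DCpoJ:
  assumes "X \<in> Ob K" "Y \<in> Ob K" "X' \<in> Ob K" "Y' \<in> Ob K"
  shows "(hom_poset K X Y, \<lambda>h\<in>Hom K X Y. \<sigma> h, hom_poset K X' Y')
      \<in> Hom DCpoJ (hom_poset K X Y) (hom_poset K X' Y') \<longleftrightarrow>
    scott_continuous (hom_poset K X Y) (hom_poset K X' Y') \<sigma>"
  using assms hom_poset_Ob scott_continuous_cong[of "hom_poset K X Y" "restrict \<sigma> (Hom K X Y)" \<sigma>]
  by (simp add: Hom_DCpoJ)

section \<open>Representables as lax functors\<close>

lemma representable_simps:
  "Y \<in> Ob K \<Longrightarrow> FOb (representable K X) Y = hom_poset K X Y"
  "g \<in> Hom K Y Z \<Longrightarrow> FArr (representable K X) g =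
     (hom_poset K X Y, \<lambda>f\<in>Hom K X Y. g \<bullet> f, hom_poset K X Z)"
  by (auto simp: representable_def Hom_def)

text \<open>A representable preserves identities and composites strictly, so both lax inequalities
  are instances of reflexivity. Postcomposition is Scott continuous by the enrichment.\<close>

lemma lax_functor_representable:
  assumes X: "X \<in> Ob K"
  shows "lax_functor K DCpoJ (representable K X)"
proof
  show "FOb (representable K X) \<in> Ob K \<rightarrow>\<^sub>E Ob DCpoJ"
    using hom_poset_Ob[OF X] by (auto simp: representable_def)
  show "FArr (representable K X) \<in> extensional (Arr K)" by (simp add: representable_def)
  show "FArr (representable K X) g
      \<in> Hom DCpoJ (FOb (representable K X) Y) (FOb (representable K X) Z)"
    if "g \<in> Hom K Y Z" for g Y Z
    using that Hom_Ob[OF that] comp_continuous_right[OF X that] X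
    by (simp add: representable_simps restrict_Hom_DCpoJ)
  show "Ident DCpoJ (FOb (representable K X) Y) \<preceq>\<^bsub>DCpoJ\<^esub> FArr (representable K X) (Ident K Y)"
    if "Y \<in> Ob K" for Y
    using that Ident_Hom[OF that]
    by (simp add: representable_simps DCpoJ_simps Ident_Comp hom_Leq_refl)
  show "FArr (representable K X) g \<bullet>\<^bsub>DCpoJ\<^esub> FArr (representable K X) h
      \<preceq>\<^bsub>DCpoJ\<^esub> FArr (representable K X) (g \<bullet> h)"
    if h: "h \<in> Hom K Y Z" and g: "g \<in> Hom K Z W" for g h Y Z W
  proof -
    have "compose (Hom K X Y) (\<lambda>f\<in>Hom K X Z. g \<bullet> f) (\<lambda>f\<in>Hom K X Y. h \<bullet> f) f
        = (\<lambda>f\<in>Hom K X Y. (g \<bullet> h) \<bullet> f) f" for f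
      using Comp_assoc[OF _ h g, of f X] Comp_Hom[OF _ h, of f X] by (simp add: compose_def)
    then show ?thesis
      using Comp_Hom[OF _ Comp_Hom[OF h g]]
      by (auto simp: representable_simps(2)[OF g] representable_simps(2)[OF h]
          representable_simps(2)[OF Comp_Hom[OF h g]] DCpoJ_simps(3,4) intro: hom_Leq_refl)
  qed
qed

section \<open>Arrows between representables as families of maps between hom-sets\<close>

lemma Hom_hat_category:
  assumes "X \<in> Ob K" and "Y \<in> Ob K"
  shows "\<phi> \<in> Hom (hat_category K) (representable K Y) (representable K X) \<longleftrightarrow>
    (\<exists>t. \<phi> = (representable K X, t, representable K Y) \<and>
       oplax_transformation K DCpoJ (representable K X) (representable K Y) t)"
  using assms lax_functor_representable
  by (simp add: hat_category_def Hom_full_subcategory Hom_lax_functor_category)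

text \<open>Both composites are evaluated at \<open>h\<close>; the membership conditions that
  \<open>hom_poset\<close> builds into its order follow from the typing of \<tau>. The passage from
  families to arrows and the passage back both rest on this.\<close>

lemma transformation_oplax_at:
  assumes g: "g \<in> Hom K Z W" and X: "X \<in> Ob K" and Y: "Y \<in> Ob K"
    and \<tau>: "\<And>Z. Z \<in> Ob K \<Longrightarrow> \<tau> Z \<in> Hom K X Z \<rightarrow> Hom K Y Z"
  shows "(hom_poset K X W, \<lambda>h\<in>Hom K X W. \<tau> W h, hom_poset K Y W)
      \<bullet>\<^bsub>DCpoJ\<^esub> FArr (representable K X) g \<preceq>\<^bsub>DCpoJ\<^esub>
    FArr (representable K Y) g
      \<bullet>\<^bsub>DCpoJ\<^esub> (hom_poset K X Z, \<lambda>h\<in>Hom K X Z. \<tau> Z h, hom_poset K Y Z) \<longleftrightarrow>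
    (\<forall>h\<in>Hom K X Z. \<tau> W (g \<bullet> h) \<preceq> g \<bullet> \<tau> Z h)"
proof -
  have "Z \<in> Ob K" "W \<in> Ob K" using Hom_Ob[OF g] by auto
  then have "g \<bullet> h \<in> Hom K X W" "\<tau> W (g \<bullet> h) \<in> Hom K Y W" "\<tau> Z h \<in> Hom K Y Z"
    "g \<bullet> \<tau> Z h \<in> Hom K Y W" if "h \<in> Hom K X Z" for h
    using that \<tau> Comp_Hom[OF _ g] by (blast dest: funcset_mem)+
  then show ?thesis
    by (simp add: representable_simps(2)[OF g] DCpoJ_simps(3,4) compose_def)
qed

lemma oplax_family_Pi:
  "\<lbrakk>oplax_family K X Y \<tau>; Z \<in> Ob K\<rbrakk> \<Longrightarrow> \<tau> Z \<in> Hom K X Z \<rightarrow> Hom K Y Z"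
  by (auto simp: oplax_family_def scott_continuous_def)

lemma transformation_Hom:
  assumes X: "X \<in> Ob K" and Y: "Y \<in> Ob K" and \<tau>: "oplax_family K X Y \<tau>"
  shows "transformation K X Y \<tau> \<in> Hom (hat_category K) (representable K Y) (representable K X)"
proof -
  have "oplax_transformation K DCpoJ (representable K X) (representable K Y)
     (\<lambda>Z\<in>Ob K. (hom_poset K X Z, \<lambda>h\<in>Hom K X Z. \<tau> Z h, hom_poset K Y Z))"
    (is "oplax_transformation _ _ _ _ ?t")
  proof
    show "?t Z \<in> Hom DCpoJ (FOb (representable K X) Z) (FOb (representable K Y) Z)"
      if "Z \<in> Ob K" for Z
      using that X Y \<tau> by (simp add: representable_simps restrict_Hom_DCpoJ oplax_family_def)
    show "?t W \<bullet>\<^bsub>DCpoJ\<^esub> FArr (representable K X) g \<preceq>\<^bsub>DCpoJ\<^esub> FArr (representable K Y) g \<bullet>\<^bsub>DCpoJ\<^esub> ?t Z"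
      if g: "g \<in> Hom K Z W" for g Z W
      using Hom_Ob[OF g] transformation_oplax_at[OF g X Y oplax_family_Pi[OF \<tau>]] \<tau> g
      by (simp add: oplax_family_def)
  qed simp
  then show ?thesis using Hom_hat_category[OF X Y] by (simp add: transformation_def)
qed

text \<open>The middle entries of the component triples supply the family. With
  \<open>transformation_Hom\<close>, arrows between representables are thus the same as oplax
  families, up to values outside the hom-sets.\<close>

lemma Hom_hat_categoryE:
  assumes X: "X \<in> Ob K" and Y: "Y \<in> Ob K"
    and \<phi>: "\<phi> \<in> Hom (hat_category K) (representable K Y) (representable K X)"
  obtains \<tau> where "oplax_family K X Y \<tau>" and "\<phi> = transformation K X Y \<tau>"
proof -
  obtain t where t: "\<phi> = (representable K X, t, representable K Y)"
    and "oplax_transformation K DCpoJ (representable K X) (representable K Y) t"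
    using \<phi> Hom_hat_category[OF X Y] by blast
  then interpret oplax_transformation K DCpoJ "representable K X" "representable K Y" t by simp
  define \<tau> where "\<tau> Z = fst (snd (t Z))" for Z
  \<comment> \<open>The map in the triple is already extensional on \<open>Hom K X Z\<close>, so
    restricting it again changes nothing.\<close>
  have tZ: "t Z = (hom_poset K X Z, \<lambda>h\<in>Hom K X Z. \<tau> Z h, hom_poset K Y Z)"
    and sc: "scott_continuous (hom_poset K X Z) (hom_poset K Y Z) (\<tau> Z)" if "Z \<in> Ob K" for Z
    using component_Hom[OF that] that
    by (auto simp: Hom_DCpoJ representable_simps \<tau>_def extensional_restrict)
  have \<tau>: "\<tau> Z \<in> Hom K X Z \<rightarrow> Hom K Y Z" if "Z \<in> Ob K" for Z
    using sc[OF that] by (simp add: scott_continuous_def)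
  have "\<tau> W (g \<bullet> h) \<preceq> g \<bullet> \<tau> Z h" if g: "g \<in> Hom K Z W" and h: "h \<in> Hom K X Z" for g h Z W
    using oplax[OF g] Hom_Ob[OF g] transformation_oplax_at[OF g X Y \<tau>] h by (simp add: tZ)
  then have "oplax_family K X Y \<tau>" using sc by (simp add: oplax_family_def)
  moreover have "t = (\<lambda>Z\<in>Ob K. (hom_poset K X Z, \<lambda>h\<in>Hom K X Z. \<tau> Z h, hom_poset K Y Z))"
    using extensional tZ by (auto intro: extensionalityI)
  then have "\<phi> = transformation K X Y \<tau>" using t by (simp add: transformation_def)
  ultimately show ?thesis by (rule that)
qed

text \<open>Passing to the opposite reverses composition, so the left factor \<tau> is applied
  first. Its values lie in \<open>Hom K Y W\<close>, where the restriction in the component of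
  \<sigma> is harmless.\<close>

lemma transformation_Comp:
  assumes "oplax_family K X Y \<tau>"
  shows "transformation K X Y \<tau> \<bullet>\<^bsub>hat_category K\<^esub> transformation K Y Z \<sigma> =
    transformation K X Z (\<lambda>W h. \<sigma> W (\<tau> W h))"
  using oplax_family_Pi[OF assms]
  by (auto simp: hat_category_def transformation_def lax_functor_category_simps(3) DCpoJ_simps(3)
      compose_def Pi_iff intro!: restrict_ext)

lemma transformation_Leq:
  assumes "oplax_family K X Y \<sigma>" and "oplax_family K X Y \<tau>"
  shows "transformation K X Y \<sigma> \<preceq>\<^bsub>hat_category K\<^esub> transformation K X Y \<tau> \<longleftrightarrow>
    (\<forall>Z\<in>Ob K. \<forall>h\<in>Hom K X Z. \<sigma> Z h \<preceq> \<tau> Z h)"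
  using oplax_family_Pi[OF assms(1)] oplax_family_Pi[OF assms(2)]
  by (auto simp: hat_category_def transformation_def lax_functor_category_simps(4) DCpoJ_simps(4)
      Pi_iff)

lemma preorder_category_hat: "preorder_category (hat_category K)"
proof -
  interpret N: preorder_category "lax_functor_category K DCpoJ"
    using preorder_category_lax_functor_category[OF category_axioms preorder_category_DCpoJ] .
  show ?thesis
    unfolding hat_category_def
    by (rule preorder_category.preorder_category_full_subcategory[OF N.preorder_category_opposite])
      (use lax_functor_representable in \<open>auto simp: lax_functor_category_simps(1)\<close>)
qed


section \<open>Coproducts of representables\<close>

text \<open>These families provide the injections of the coproduct. Continuity is that of
  composition in its left argument, and by associativity the oplax inequality is an
  equality.\<close>

lemma oplax_family_Comp:
  assumes f: "f \<in> Hom K X Y"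
  shows "oplax_family K Y X (\<lambda>Z h. h \<bullet> f)"
  unfolding oplax_family_def
proof (intro conjI ballI allI impI)
  show "scott_continuous (hom_poset K Y Z) (hom_poset K X Z) (\<lambda>h. h \<bullet> f)" if "Z \<in> Ob K" for Z
    using comp_continuous_left[OF that f] .
  show "(g \<bullet> h) \<bullet> f \<preceq> g \<bullet> (h \<bullet> f)" if "g \<in> Hom K Z Z'" "h \<in> Hom K Y Z" for Z Z' g h
    using that f by (simp add: Comp_assoc hom_Leq_refl[OF Comp_Hom[OF Comp_Hom]])
qed

text \<open>This gives the mediating arrow out of \<open>representable K P\<close>. Monotonicity,
  preservation of directed suprema and oplaxness are each checked after restriction along the
  injections, where they are properties of the \<open>\<tau> i\<close>, and are carried back by
  monotone cotupling.\<close>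

lemma oplax_family_cotuple:
  assumes P: "is_coproduct K I X P \<iota>" and X: "X \<in> I \<rightarrow> Ob K" and Y: "Y \<in> Ob K"
    and cotupling: "cotupling_preserves_order K I"
    and \<tau>: "\<And>i. i \<in> I \<Longrightarrow> oplax_family K Y (X i) (\<tau> i)"
  shows "oplax_family K Y P (\<lambda>Z h. cotuple K I P \<iota> Z (\<lambda>i. \<tau> i Z h))"
proof -
  define \<kappa> where "\<kappa> Z h = cotuple K I P \<iota> Z (\<lambda>i. \<tau> i Z h)" for Z h
  have P_Ob: "P \<in> Ob K" and \<iota>: "\<And>i. i \<in> I \<Longrightarrow> \<iota> i \<in> Hom K (X i) P"
    using P by (auto simp: is_coproduct_def)
  have \<tau>_Hom: "\<tau> i Z h \<in> Hom K (X i) Z" if "i \<in> I" "h \<in> Hom K Y Z" for i Z h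
    using oplax_family_Pi[OF \<tau>[OF that(1)], of Z] that Hom_Ob[OF that(2)] by auto
  note mono = cotuple_mono[OF cotupling X P]
  have \<kappa>_Hom: "\<kappa> Z h \<in> Hom K P Z" if "h \<in> Hom K Y Z" for h Z
    unfolding \<kappa>_def using that Hom_Ob[OF that] \<tau>_Hom by (intro cotuple_Hom[OF P]) auto
  have \<kappa>_Comp: "\<kappa> Z h \<bullet> \<iota> i = \<tau> i Z h" if "h \<in> Hom K Y Z" "i \<in> I" for h i Z
    unfolding \<kappa>_def using that Hom_Ob[OF that(1)] \<tau>_Hom by (intro cotuple_Comp[OF P]) auto
  \<comment> \<open>With \<open>mono\<close>, this reduces an inequality between arrows out of
    \<open>P\<close> to its restrictions along the injections.\<close>
  have cotuple_Comp_\<iota>: "cotuple K I P \<iota> Z (\<lambda>i. u \<bullet> \<iota> i) = u" if "u \<in> Hom K P Z" for u Z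
    using that Hom_Ob[OF that] Comp_Hom[OF \<iota> that] by (intro cotuple_equality[OF P]) auto
  have \<kappa>_mono: "\<kappa> Z f \<preceq> \<kappa> Z g"
    if "f \<in> Hom K Y Z" "g \<in> Hom K Y Z" "f \<preceq> g" for f g Z
    unfolding \<kappa>_def
  proof (rule mono)
    fix i assume i: "i \<in> I"
    have Z: "Z \<in> Ob K" using Hom_Ob[OF that(1)] by simp
    have "scott_continuous (hom_poset K Y Z) (hom_poset K (X i) Z) (\<tau> i Z)"
      using \<tau>[OF i] Z by (simp add: oplax_family_def)
    from scott_continuous_mono[OF this, of f g] show "\<tau> i Z f \<preceq> \<tau> i Z g" using that by simp
  qed (use that Hom_Ob \<tau>_Hom in auto)
  have "scott_continuous (hom_poset K Y Z) (hom_poset K P Z) (\<kappa> Z)" if Z: "Z \<in> Ob K" for Z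
    unfolding scott_continuous_def
  proof (intro conjI allI impI)
    show "\<kappa> Z \<in> carrier (hom_poset K Y Z) \<rightarrow> carrier (hom_poset K P Z)" using \<kappa>_Hom by auto
    show "isotone (hom_poset K Y Z) (hom_poset K P Z) (\<kappa> Z)"
      using hom_dcpo_join Y Z P_Ob \<kappa>_Hom \<kappa>_mono
      by (auto simp: isotone_def intro: dcpo_join_weak_partial_order)
    fix S s
    assume S: "directed (hom_poset K Y Z) S \<and> is_lub (hom_poset K Y Z) s S"
    then have S_Hom: "S \<subseteq> Hom K Y Z" and s: "s \<in> Hom K Y Z"
      and ub: "\<And>f. f \<in> S \<Longrightarrow> f \<preceq> s"
      by (auto simp: directed_def least_def Upper_def)
    show "is_lub (hom_poset K P Z) (\<kappa> Z s) (\<kappa> Z ` S)"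
    proof (rule least_UpperI)
      show "x \<sqsubseteq>\<^bsub>hom_poset K P Z\<^esub> \<kappa> Z s" if "x \<in> \<kappa> Z ` S" for x
        using that S_Hom s ub \<kappa>_mono \<kappa>_Hom by auto
      show "\<kappa> Z ` S \<subseteq> carrier (hom_poset K P Z)" using S_Hom \<kappa>_Hom by auto
      show "\<kappa> Z s \<in> carrier (hom_poset K P Z)" using s \<kappa>_Hom by simp
      show "\<kappa> Z s \<sqsubseteq>\<^bsub>hom_poset K P Z\<^esub> u" if "u \<in> Upper (hom_poset K P Z) (\<kappa> Z ` S)" for u
      proof -
        have u: "u \<in> Hom K P Z" and \<kappa>u: "\<And>f. f \<in> S \<Longrightarrow> \<kappa> Z f \<preceq> u"
          using that S_Hom \<kappa>_Hom by (auto simp: Upper_def)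
        \<comment> \<open>An upper bound \<open>u\<close> of the image of \<open>S\<close> under
          \<open>\<kappa> Z\<close> restricts along \<open>\<iota> i\<close> to an upper bound of
          the image under \<open>\<tau> i Z\<close>, as precomposition is monotone. Continuity of
          \<open>\<tau> i Z\<close> makes \<open>\<tau> i Z s\<close> the least such bound.\<close>
        have "\<tau> i Z s \<preceq> u \<bullet> \<iota> i" if i: "i \<in> I" for i
        proof -
          have "is_lub (hom_poset K (X i) Z) (\<tau> i Z s) (\<tau> i Z ` S)"
            using \<tau>[OF i] Z S by (simp add: oplax_family_def scott_continuous_def)
          moreover have "u \<bullet> \<iota> i \<in> Upper (hom_poset K (X i) Z) (\<tau> i Z ` S)"
          proof -
            have "\<tau> i Z f \<preceq> u \<bullet> \<iota> i" if f: "f \<in> S" for f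
              using scott_continuous_mono[OF comp_continuous_left[OF Z \<iota>[OF i]], of "\<kappa> Z f" u]
                \<kappa>u[OF f] \<kappa>_Hom[of f Z] \<kappa>_Comp[of f Z i] u f S_Hom i by auto
            then show ?thesis
              using S_Hom \<tau>_Hom[OF i] Comp_Hom[OF \<iota>[OF i] u] by (auto simp: Upper_def)
          qed
          ultimately show ?thesis by (auto dest: least_le)
        qed
        then have "\<kappa> Z s \<preceq> cotuple K I P \<iota> Z (\<lambda>i. u \<bullet> \<iota> i)"
          unfolding \<kappa>_def using Z \<tau>_Hom[OF _ s] Comp_Hom[OF \<iota> u] by (intro mono) auto
        then show ?thesis using cotuple_Comp_\<iota>[OF u] u \<kappa>_Hom[OF s] by simp
      qed
    qed
  qed
  moreover have "\<kappa> W (g \<bullet> h) \<preceq> g \<bullet> \<kappa> Z h" if g: "g \<in> Hom K Z W" and h: "h \<in> Hom K Y Z" for Z W g h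
  proof -
    \<comment> \<open>By associativity \<open>g \<bullet> \<kappa> Z h\<close> restricts along
      \<open>\<iota> i\<close> to \<open>g \<bullet> \<tau> i Z h\<close>, so this is the oplax
      inequality of \<open>\<tau> i\<close>.\<close>
    have "\<tau> i W (g \<bullet> h) \<preceq> (g \<bullet> \<kappa> Z h) \<bullet> \<iota> i" if i: "i \<in> I" for i
      using \<tau>[OF i] g h Comp_assoc[OF \<iota>[OF i] \<kappa>_Hom[OF h] g] \<kappa>_Comp[OF h i]
      by (simp add: oplax_family_def)
    then have "\<kappa> W (g \<bullet> h) \<preceq> cotuple K I P \<iota> W (\<lambda>i. (g \<bullet> \<kappa> Z h) \<bullet> \<iota> i)"
      unfolding \<kappa>_def[of W] using Hom_Ob[OF g] \<tau>_Hom[OF _ Comp_Hom[OF h g]]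
        Comp_Hom[OF \<iota> Comp_Hom[OF \<kappa>_Hom[OF h] g]] by (intro mono) auto
    then show ?thesis using cotuple_Comp_\<iota>[OF Comp_Hom[OF \<kappa>_Hom[OF h] g]] by simp
  qed
  ultimately show ?thesis unfolding oplax_family_def \<kappa>_def[symmetric] by blast
qed

text \<open>The universal property is inherited from \<open>K\<close> at each \<open>Z\<close> and
  \<open>h\<close>. The explicit formula for cotuples reduces their monotonicity to that in
  \<open>K\<close>. \<open>F\<close> is tied to representables over \<open>I\<close> only, because a
  family is arbitrary outside its index set.\<close>

lemma coproduct_representable:
  assumes P: "is_coproduct K I X P \<iota>" and X: "X \<in> I \<rightarrow> Ob K"
    and cotupling: "cotupling_preserves_order K I"
    and F: "\<And>i. i \<in> I \<Longrightarrow> F i = representable K (X i)"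
  defines "\<iota>' \<equiv> \<lambda>i. transformation K P (X i) (\<lambda>Z h. h \<bullet> \<iota> i)"
  shows is_coproduct_representable:
      "is_coproduct (hat_category K) I F (representable K P) \<iota>'" (is ?coproduct)
    and cotuple_representable:
      "\<lbrakk>Y \<in> Ob K; \<And>i. i \<in> I \<Longrightarrow> oplax_family K Y (X i) (\<tau> i);
        \<And>i. i \<in> I \<Longrightarrow> f i = transformation K Y (X i) (\<tau> i)\<rbrakk> \<Longrightarrow>
       cotuple (hat_category K) I (representable K P) \<iota>' (representable K Y) f =
       transformation K Y P (\<lambda>Z h. cotuple K I P \<iota> Z (\<lambda>i. \<tau> i Z h))"
proof -
  have P_Ob: "P \<in> Ob K" and \<iota>: "\<And>i. i \<in> I \<Longrightarrow> \<iota> i \<in> Hom K (X i) P"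
    using P by (auto simp: is_coproduct_def)
  have X_Ob: "X i \<in> Ob K" if "i \<in> I" for i using X that by auto
  have \<iota>': "\<iota>' i \<in> Hom (hat_category K) (F i) (representable K P)" if "i \<in> I" for i
    unfolding \<iota>'_def F[OF that]
    using P_Ob X_Ob[OF that] oplax_family_Comp[OF \<iota>[OF that]] by (rule transformation_Hom)
  have Comp_\<iota>': "transformation K Y P \<sigma> \<bullet>\<^bsub>hat_category K\<^esub> \<iota>' i =
      transformation K Y (X i) (\<lambda>Z h. \<sigma> Z h \<bullet> \<iota> i)"
    if "oplax_family K Y P \<sigma>" for Y \<sigma> i
    unfolding \<iota>'_def using that by (rule transformation_Comp)
  \<comment> \<open>For one family these two facts give existence and uniqueness in the universal
    property; \<open>sol\<close> also identifies the cotuple in the second conclusion.\<close>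
  have sol: "transformation K Y P \<kappa> \<in> Hom (hat_category K) (representable K P) (representable K Y) \<and>
      (\<forall>i\<in>I. transformation K Y P \<kappa> \<bullet>\<^bsub>hat_category K\<^esub> \<iota>' i = f i)" (is ?sol)
    and unique: "\<And>\<phi>. \<lbrakk>\<phi> \<in> Hom (hat_category K) (representable K P) (representable K Y);
      \<forall>i\<in>I. \<phi> \<bullet>\<^bsub>hat_category K\<^esub> \<iota>' i = f i\<rbrakk> \<Longrightarrow> \<phi> = transformation K Y P \<kappa>"
    if Y: "Y \<in> Ob K" and \<tau>: "\<And>i. i \<in> I \<Longrightarrow> oplax_family K Y (X i) (\<tau> i)"
      and f: "\<And>i. i \<in> I \<Longrightarrow> f i = transformation K Y (X i) (\<tau> i)"
      and \<kappa>: "\<kappa> = (\<lambda>Z h. cotuple K I P \<iota> Z (\<lambda>i. \<tau> i Z h))"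
    for Y \<tau> f \<kappa>
  proof -
    have fam: "oplax_family K Y P \<kappa>"
      unfolding \<kappa> using oplax_family_cotuple[OF P X Y cotupling \<tau>] .
    have \<tau>_Hom: "\<tau> i Z h \<in> Hom K (X i) Z" if "i \<in> I" "h \<in> Hom K Y Z" for i Z h
      using oplax_family_Pi[OF \<tau>[OF that(1)], of Z] that Hom_Ob[OF that(2)] by auto
    have "\<kappa> Z h \<bullet> \<iota> i = \<tau> i Z h" if "Z \<in> Ob K" "h \<in> Hom K Y Z" "i \<in> I" for Z h i
      unfolding \<kappa> using that \<tau>_Hom by (intro cotuple_Comp[OF P]) auto
    then show ?sol
      using transformation_Hom[OF Y P_Ob fam]
      by (auto simp: Comp_\<iota>'[OF fam] f transformation_eq_iff)
    fix \<phi> assume "\<phi> \<in> Hom (hat_category K) (representable K P) (representable K Y)"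
      and comm: "\<forall>i\<in>I. \<phi> \<bullet>\<^bsub>hat_category K\<^esub> \<iota>' i = f i"
    then obtain \<sigma> where \<sigma>: "oplax_family K Y P \<sigma>" "\<phi> = transformation K Y P \<sigma>"
      using Hom_hat_categoryE[OF Y P_Ob] by blast
    \<comment> \<open>Commutation says that \<open>\<sigma> Z h\<close> restricts along each
      injection to \<open>\<tau> i Z h\<close>, so uniqueness in \<open>K\<close> forces it to be
      the cotuple.\<close>
    have "\<sigma> Z h = \<kappa> Z h" if Z: "Z \<in> Ob K" and h: "h \<in> Hom K Y Z" for Z h
      unfolding \<kappa>
    proof (rule cotuple_equality[OF P Z, symmetric])
      show "\<sigma> Z h \<in> Hom K P Z" using oplax_family_Pi[OF \<sigma>(1) Z] h by auto
      show "\<sigma> Z h \<bullet> \<iota> i = \<tau> i Z h" if "i \<in> I" for i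
        using comm that f[OF that] Z h by (auto simp: \<sigma>(2) Comp_\<iota>'[OF \<sigma>(1)] transformation_eq_iff)
    qed (rule \<tau>_Hom[OF _ h])
    then show "\<phi> = transformation K Y P \<kappa>" by (simp add: \<sigma>(2) transformation_eq_iff)
  qed
  show ?coproduct
    unfolding is_coproduct_def
  proof (intro conjI ballI allI impI)
    show "representable K P \<in> Ob (hat_category K)" using P_Ob by (simp add: Ob_hat_category)
    show "\<iota>' i \<in> Hom (hat_category K) (F i) (representable K P)" if "i \<in> I" for i
      using \<iota>'[OF that] .
    fix G f
    assume "G \<in> Ob (hat_category K)" and f: "\<forall>i\<in>I. f i \<in> Hom (hat_category K) (F i) G"
    then obtain Y where Y: "Y \<in> Ob K" and G: "G = representable K Y"
      by (auto simp: Ob_hat_category)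
    have "\<forall>i\<in>I. \<exists>\<tau>. oplax_family K Y (X i) \<tau> \<and> f i = transformation K Y (X i) \<tau>"
      using f F G Hom_hat_categoryE[OF Y X_Ob] by metis
    then obtain \<tau> where "\<And>i. i \<in> I \<Longrightarrow> oplax_family K Y (X i) (\<tau> i)"
      and "\<And>i. i \<in> I \<Longrightarrow> f i = transformation K Y (X i) (\<tau> i)"
      by (metis bchoice)
    from sol[OF Y this refl] unique[OF Y this refl]
    show "\<exists>!h. h \<in> Hom (hat_category K) (representable K P) G \<and>
        (\<forall>i\<in>I. h \<bullet>\<^bsub>hat_category K\<^esub> \<iota>' i = f i)"
      unfolding G by blast
  qed
  then show "cotuple (hat_category K) I (representable K P) \<iota>' (representable K Y) f =
       transformation K Y P (\<lambda>Z h. cotuple K I P \<iota> Z (\<lambda>i. \<tau> i Z h))"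
    if Y: "Y \<in> Ob K" and \<tau>: "\<And>i. i \<in> I \<Longrightarrow> oplax_family K Y (X i) (\<tau> i)"
      and f: "\<And>i. i \<in> I \<Longrightarrow> f i = transformation K Y (X i) (\<tau> i)" for Y \<tau> f
  proof (rule cotuple_equality)
    show "representable K Y \<in> Ob (hat_category K)" using Y by (simp add: Ob_hat_category)
    show "f i \<in> Hom (hat_category K) (F i) (representable K Y)" if "i \<in> I" for i
      using transformation_Hom[OF Y X_Ob[OF that] \<tau>[OF that]] f[OF that] F[OF that] by simp
  qed (use sol[OF Y \<tau> f refl] in auto)
qed

end

theorem theorem4p3:
  fixes D :: "('d, 'e) category"
    and K :: "('o, 'a) ord_category"
  assumes "category D"
    and "DCpoJ_enriched K"
    and "has_coproducts K (Ob D)"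
    and "cotupling_preserves_order K (Ob D)"
  shows "has_coproducts (hat_category K) (Ob D) \<and>
         cotupling_preserves_order (hat_category K) (Ob D)"
proof -
  interpret K: DCpoJ_enriched K by fact
  interpret N: preorder_category "hat_category K" by (rule K.preorder_category_hat)
  \<comment> \<open>Every object of \<open>hat_category K\<close> is represented by some object of
    \<open>K\<close>. Choosing one for each index gives a family in \<open>K\<close>, which has a
    coproduct by hypothesis.\<close>
  have family: "\<exists>X P \<iota>. X \<in> Ob D \<rightarrow> Ob K \<and> (\<forall>i\<in>Ob D. F i = representable K (X i)) \<and>
      is_coproduct K (Ob D) X P \<iota>"
    if "F \<in> Ob D \<rightarrow> Ob (hat_category K)" for F
  proof -
    have "\<forall>i\<in>Ob D. \<exists>Y. Y \<in> Ob K \<and> F i = representable K Y"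
      using that by (auto simp: Ob_hat_category)
    then obtain X where "\<forall>i\<in>Ob D. X i \<in> Ob K \<and> F i = representable K (X i)"
      by (metis bchoice)
    then show ?thesis using assms(3) by (auto simp: has_coproducts_def Pi_iff)
  qed
  have "has_coproducts (hat_category K) (Ob D)"
    unfolding has_coproducts_def
    using family K.is_coproduct_representable[OF _ _ assms(4)] by blast
  moreover have "cotupling_preserves_order (hat_category K) (Ob D)"
  \<comment> \<open>One coproduct of each family suffices; it is taken to be the one built from a
    coproduct in \<open>K\<close>, whose cotuples are known explicitly.\<close>
  proof (rule N.cotupling_preserves_orderI)
    fix F assume "F \<in> Ob D \<rightarrow> Ob (hat_category K)"
    then obtain X P \<iota> where X: "X \<in> Ob D \<rightarrow> Ob K" and P: "is_coproduct K (Ob D) X P \<iota>"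
      and F: "\<And>i. i \<in> Ob D \<Longrightarrow> F i = representable K (X i)"
      using family by blast
    define \<iota>' where "\<iota>' i = transformation K P (X i) (\<lambda>Z h. h \<bullet>\<^bsub>K\<^esub> \<iota> i)" for i
    let ?cotuple = "cotuple (hat_category K) (Ob D) (representable K P) \<iota>'"
    have X_Ob: "X i \<in> Ob K" if "i \<in> Ob D" for i using X that by auto
    have "?cotuple G f \<preceq>\<^bsub>hat_category K\<^esub> ?cotuple G g"
      if G: "G \<in> Ob (hat_category K)"
        and fg: "\<forall>i\<in>Ob D. f i \<in> Hom (hat_category K) (F i) G \<and>
          g i \<in> Hom (hat_category K) (F i) G \<and> f i \<preceq>\<^bsub>hat_category K\<^esub> g i" for G f g
    proof -
      obtain Y where Y: "Y \<in> Ob K" and G: "G = representable K Y"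
        using G by (auto simp: Ob_hat_category)
      \<comment> \<open>A cocone under \<open>F\<close> is turned into oplax families, one chosen
        for each index. This is applied to \<open>f\<close> and to \<open>g\<close>.\<close>
      have components: "\<exists>\<tau>. \<forall>i\<in>Ob D. oplax_family K Y (X i) (\<tau> i) \<and>
          k i = transformation K Y (X i) (\<tau> i)"
        if "\<forall>i\<in>Ob D. k i \<in> Hom (hat_category K) (F i) G" for k
      proof (rule bchoice, rule ballI)
        fix i assume i: "i \<in> Ob D"
        then have "k i \<in> Hom (hat_category K) (representable K (X i)) (representable K Y)"
          using that F G by simp
        then show "\<exists>\<tau>. oplax_family K Y (X i) \<tau> \<and> k i = transformation K Y (X i) \<tau>"
          using K.Hom_hat_categoryE[OF Y X_Ob[OF i]] by metis
      qed
      obtain \<sigma> where \<sigma>: "\<And>i. i \<in> Ob D \<Longrightarrow> oplax_family K Y (X i) (\<sigma> i)"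
          "\<And>i. i \<in> Ob D \<Longrightarrow> f i = transformation K Y (X i) (\<sigma> i)"
        using components[of f] fg by auto
      obtain \<tau> where \<tau>: "\<And>i. i \<in> Ob D \<Longrightarrow> oplax_family K Y (X i) (\<tau> i)"
          "\<And>i. i \<in> Ob D \<Longrightarrow> g i = transformation K Y (X i) (\<tau> i)"
        using components[of g] fg by auto
      have le: "\<sigma> i Z h \<preceq>\<^bsub>K\<^esub> \<tau> i Z h" if "i \<in> Ob D" "Z \<in> Ob K" "h \<in> Hom K Y Z" for i Z h
        using fg that \<sigma> \<tau> K.transformation_Leq[OF \<sigma>(1) \<tau>(1)] by auto
      have Hom: "\<sigma> i Z h \<in> Hom K (X i) Z" "\<tau> i Z h \<in> Hom K (X i) Z"
        if "i \<in> Ob D" "Z \<in> Ob K" "h \<in> Hom K Y Z" for i Z h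
        using that K.oplax_family_Pi[OF \<sigma>(1)] K.oplax_family_Pi[OF \<tau>(1)]
        by (auto simp: Pi_iff)
      \<comment> \<open>Since cotuples and order in \<open>hat_category K\<close> are both
        pointwise, monotone cotupling in \<open>K\<close> is applied separately for every
        \<open>Z\<close> and \<open>h\<close>.\<close>
      have "cotuple K (Ob D) P \<iota> Z (\<lambda>i. \<sigma> i Z h) \<preceq>\<^bsub>K\<^esub> cotuple K (Ob D) P \<iota> Z (\<lambda>i. \<tau> i Z h)"
        if "Z \<in> Ob K" "h \<in> Hom K Y Z" for Z h
        using that Hom le by (intro cotuple_mono[OF assms(4) X P]) auto
      then have "transformation K Y P (\<lambda>Z h. cotuple K (Ob D) P \<iota> Z (\<lambda>i. \<sigma> i Z h))
          \<preceq>\<^bsub>hat_category K\<^esub> transformation K Y P (\<lambda>Z h. cotuple K (Ob D) P \<iota> Z (\<lambda>i. \<tau> i Z h))"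
        using K.transformation_Leq K.oplax_family_cotuple[OF P X Y assms(4)] \<sigma>(1) \<tau>(1)
        by simp
      then show ?thesis
        unfolding G \<iota>'_def
        using K.cotuple_representable[OF P X assms(4) F Y \<sigma>]
          K.cotuple_representable[OF P X assms(4) F Y \<tau>] by simp
    qed
    moreover have "is_coproduct (hat_category K) (Ob D) F (representable K P) \<iota>'"
      unfolding \<iota>'_def using K.is_coproduct_representable[OF P X assms(4) F] .
    ultimately show "\<exists>Q \<kappa>. is_coproduct (hat_category K) (Ob D) F Q \<kappa> \<and>
        (\<forall>G\<in>Ob (hat_category K). \<forall>f g.
          (\<forall>i\<in>Ob D. f i \<in> Hom (hat_category K) (F i) G \<and> g i \<in> Hom (hat_category K) (F i) G \<and>
             f i \<preceq>\<^bsub>hat_category K\<^esub> g i) \<longrightarrow>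
          cotuple (hat_category K) (Ob D) Q \<kappa> G f \<preceq>\<^bsub>hat_category K\<^esub>
          cotuple (hat_category K) (Ob D) Q \<kappa> G g)"
      by blast
  qed
  ultimately show ?thesis by blast
qed

end
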